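(* Let $n\ge2$, let $y,z\in\mathbb{R}^n$, and let $w_1,w_2\in\mathbb{R}^n$ be vectors with strictly positive components $w_{1,i},w_{2,i}$. Let $(a^*,b^* )$ be the unique minimizer of $$L_2(a,b)=\sum_{i=1}^n w_{1,i}(y_i-a_i)^2+\sum_{i=1}^n w_{2,i}(z_i-b_i)^2$$ over the set of pairs $(a,b)\in\mathbb{R}^n\times\mathbb{R}^n$ with $a_1\le\dots\le a_n$, $b_1\le\dots\le b_n$ and $a_i\le b_i$ for all $i$. Consider the convex set $$\mathcal{I}^{b^*_n}_{n-1}=\{(b_1,\dots,b_{n-1})\in\mathbb{R}^{n-1}:\ b_1\le b_2\le\dots\le b_{n-1}\le b^*_n\}$$ and, on this set, the criterion $$\Psi(b_1,\dots,b_{n-1})=\sum_{i=1}^n\Big(\max_{1\le s\le i}(G_{s,i}\wedge b_s)-y_i\Big)^2w_{1,i}+\sum_{i=1}^{n-1}(b_i-z_i)^2w_{2,i},$$ where $b_n:=b^*_n$ in this formula and, for $1\le s\le i\le n$, $$G_{s,i}=\min_{i\le t\le n}Av_1(\{s,\dots,t\}).$$ Then $\Psi$ is convex, and its unique minimizer $(b^{**}_1,\dots,b^{**}_{n-1})$ over $\mathcal{I}^{b^*_n}_{n-1}$ equals $(b^*_1,\dots,b^*_{n-1})$.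
   Context: For nonempty $A\subseteq\{1,\dots,n\}$, $Av_1(A)=\sum_{i\in A}y_iw_{1,i}\big/\sum_{i\in A}w_{1,i}$. For real numbers $x,x'$, $x\wedge x'=\min(x,x')$. The minimizer of $L_2$ over the stated set exists and is unique, since the set is closed and convex and $L_2$ is strictly convex. Convexity of $\Psi$ is understood as convexity of the function $\Psi:\mathcal{I}^{b^*_n}_{n-1}\to\mathbb{R}$. *)

theory Defs
  imports "HOL-Analysis.Analysis" "HOL-Library.Function_Algebras"
begin

(* Vectors of varying dimension are functions nat => real supported on {1..n}; with the
   pointwise vector space structure on functions, which HOL-Analysis does not provide as a
   class instance, convex_on applies to them. *)

instantiation "fun" :: (type, real_vector) real_vector
begin

definition scaleR_fun :: "real \<Rightarrow> ('a \<Rightarrow> 'b) \<Rightarrow> 'a \<Rightarrow> 'b" where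
  "scaleR_fun r f = (\<lambda>x. r *\<^sub>R f x)"

instance
  by standard (simp_all add: scaleR_fun_def fun_eq_iff scaleR_add_right scaleR_add_left)

end

definition Rvec :: "nat \<Rightarrow> (nat \<Rightarrow> real) set" where
  "Rvec n = {x. \<forall>i. i \<notin> {1..n} \<longrightarrow> x i = 0}"

definition is_unique_minimizer :: "('a \<Rightarrow> real) \<Rightarrow> 'a set \<Rightarrow> 'a \<Rightarrow> bool" where
  "is_unique_minimizer f S x \<longleftrightarrow>
     is_arg_min f (\<lambda>v. v \<in> S) x \<and> (\<forall>v. is_arg_min f (\<lambda>v. v \<in> S) v \<longrightarrow> v = x)"

definition L2 :: "nat \<Rightarrow> (nat \<Rightarrow> real) \<Rightarrow> (nat \<Rightarrow> real) \<Rightarrow> (nat \<Rightarrow> real) \<Rightarrow> (nat \<Rightarrow> real) \<Rightarrow>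
    (nat \<Rightarrow> real) \<times> (nat \<Rightarrow> real) \<Rightarrow> real" where
  "L2 n y z w1 w2 = (\<lambda>(a, b).
     (\<Sum>i=1..n. w1 i * (y i - a i)\<^sup>2) + (\<Sum>i=1..n. w2 i * (z i - b i)\<^sup>2))"

definition ordered_pairs :: "nat \<Rightarrow> ((nat \<Rightarrow> real) \<times> (nat \<Rightarrow> real)) set" where
  "ordered_pairs n = {(a, b). a \<in> Rvec n \<and> b \<in> Rvec n \<and>
     mono_on {1..n} a \<and> mono_on {1..n} b \<and> (\<forall>i\<in>{1..n}. a i \<le> b i)}"

definition Av :: "(nat \<Rightarrow> real) \<Rightarrow> (nat \<Rightarrow> real) \<Rightarrow> nat set \<Rightarrow> real" where
  "Av y w A = (\<Sum>i\<in>A. y i * w i) / (\<Sum>i\<in>A. w i)"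

definition G :: "nat \<Rightarrow> (nat \<Rightarrow> real) \<Rightarrow> (nat \<Rightarrow> real) \<Rightarrow> nat \<Rightarrow> nat \<Rightarrow> real" where
  "G n y w1 s i = Min ((\<lambda>t. Av y w1 {s..t}) ` {i..n})"

definition bounded_mono :: "nat \<Rightarrow> real \<Rightarrow> (nat \<Rightarrow> real) set" where
  "bounded_mono m \<beta> = {b \<in> Rvec m. mono_on {1..m} b \<and> b m \<le> \<beta>}"

(* Psi takes a vector b of dimension n - 1; the parameter \<beta> plays the role of its n-th entry. *)
definition Psi :: "nat \<Rightarrow> (nat \<Rightarrow> real) \<Rightarrow> (nat \<Rightarrow> real) \<Rightarrow> (nat \<Rightarrow> real) \<Rightarrow> (nat \<Rightarrow> real) \<Rightarrow> real \<Rightarrow>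
    (nat \<Rightarrow> real) \<Rightarrow> real" where
  "Psi n y z w1 w2 \<beta> b =
     (\<Sum>i=1..n. (Max ((\<lambda>s. min (G n y w1 s i) ((b(n := \<beta>)) s)) ` {1..i}) - y i)\<^sup>2 * w1 i)
     + (\<Sum>i=1..n-1. (b i - z i)\<^sup>2 * w2 i)"

end

theory Submission
  imports Defs
begin

text \<open>
  For monotone \<open>b\<close> the max-min vector inside \<open>Psi\<close> is the weighted least squares fit of \<open>y\<close> among the
  monotone vectors below \<open>b\<close>. Writing \<open>(y - c)\<^sup>2\<close> as an integral over thresholds \<open>t \<le> c\<close> reduces this
  optimality to one combinatorial inequality for each \<open>t\<close>: the upper set where the max-min vector is
  at least \<open>t\<close> maximizes \<open>\<Sum>w\<^sub>i (y\<^sub>i - t)\<close> among the upper sets contained in \<open>{b \<ge> t}\<close>. Hence, up to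
  a constant, \<open>Psi\<close> is the partial minimum of the convex function \<open>L2\<close> over its first argument, with
  the last entry of the second argument held fixed; convexity and the location of the minimizer follow.
\<close>

section \<open>Upper sets with maximal sum\<close>

text \<open>In terms of tail sums \<open>S\<close>, a nonnegative sum over \<open>{s..r}\<close>
  means \<open>S (Suc r) \<le> S s\<close>. The set \<open>U\<close> turns out to be a tail
  \<open>{k..n}\<close>, and \<open>S k\<close> bounds \<open>S j\<close> for every admissible start
  \<open>j\<close>; the index \<open>n + 1\<close> stands for the empty tail.\<close>

lemma sum_tail_le_sum_max_upper_set:
  fixes x :: "nat \<Rightarrow> real" and P :: "nat \<Rightarrow> bool" and n :: nat
  defines "U \<equiv> {i \<in> {1..n}. \<exists>s\<in>{1..i}. P s \<and> (\<forall>r\<in>{i..n}. 0 \<le> sum x {s..r})}"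
  assumes j: "j \<in> {1..n + 1}" "j \<le> n \<Longrightarrow> P j"
  shows "sum x {j..n} \<le> sum x U"
proof -
  define S where "S = (\<lambda>k. sum x {k..n})"
  have S: "sum x {s..r} = S s - S (Suc r)" if "s \<le> Suc r" "r \<le> n" for s r
    using sum.ub_add_nat[of s r x "n - r"] that by (simp add: S_def)
  define k where "k = Min (insert (n + 1) U)"
  have fin: "finite U" by (simp add: U_def)
  have k_cases: "k = n + 1 \<or> k \<in> U"
    using Min_in[of "insert (n + 1) U"] fin by (auto simp: k_def)
  have k1: "1 \<le> k" "k \<le> n + 1" using k_cases by (auto simp: U_def)
  have k_le: "k \<le> i" if "i \<in> U" for i using fin that by (simp add: k_def)
  have up: "i' \<in> U" if "i \<in> U" "i \<le> i'" "i' \<le> n" for i i'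
    using that by (fastforce simp: U_def)
  have U_bound: "i \<le> n" if "i \<in> U" for i using that by (simp add: U_def)
  have U: "U = {k..n}"
  proof
    show "U \<subseteq> {k..n}" using k_le U_bound by auto
    show "{k..n} \<subseteq> U"
    proof
      fix i assume i: "i \<in> {k..n}"
      then have "k \<in> U" using k_cases by auto
      then show "i \<in> U" using up[of k i] i by simp
    qed
  qed
  \<comment> \<open>As \<open>k - 1\<close> lies outside \<open>U\<close>, an admissible
    \<open>s < k\<close> has a negative sum up to some \<open>r \<ge> k - 1\<close>, so its tail sum
    is exceeded at \<open>Suc r \<ge> k\<close>.\<close>
  have below: "\<exists>r\<in>{k..n + 1}. S s < S r" if "P s" "1 \<le> s" "s < k" for s
  proof -
    have "k - 1 \<notin> U" using k_le[of "k - 1"] that by auto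
    moreover have "k - 1 \<in> {1..n}" "s \<in> {1..k - 1}" using that k1 by auto
    ultimately have "\<not> (\<forall>r\<in>{k - 1..n}. 0 \<le> sum x {s..r})"
      using \<open>P s\<close> unfolding U_def by blast
    then obtain r where r: "r \<in> {k - 1..n}" "sum x {s..r} < 0"
      by (meson not_le)
    then have "S s < S (Suc r)" using S[of s r] that by auto
    then show ?thesis using r that by (intro bexI[of _ "Suc r"]) auto
  qed
  \<comment> \<open>A witness \<open>s\<close> for \<open>k \<in> U\<close> dominates all indices
    beyond \<open>k\<close>. If \<open>s < k\<close>, then \<open>below\<close> yields an index in
    \<open>{k..n + 1}\<close> that exceeds \<open>s\<close>, and only \<open>k\<close> itself is
    left.\<close>
  have above: "S r \<le> S k" if r: "k < r" "r \<le> n + 1" for r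
  proof -
    have "k \<in> U" using k_cases r by auto
    then obtain s where s: "1 \<le> s" "s \<le> k" "P s" "\<forall>r\<in>{k..n}. 0 \<le> sum x {s..r}"
      by (auto simp: U_def)
    have ge: "S r' \<le> S s" if "k < r'" "r' \<le> n + 1" for r'
    proof (cases r')
      case (Suc q)
      then show ?thesis using s(4)[rule_format, of q] S[of s q] that s(2) by simp
    qed (use that in simp)
    have "S s \<le> S k"
    proof (cases "s < k")
      case True
      then obtain r' where r': "r' \<in> {k..n + 1}" "S s < S r'" using below s by blast
      then have "r' = k" using ge[of r'] by (cases "r' = k") auto
      then show ?thesis using r' by simp
    qed (use s in auto)
    then show ?thesis using ge[of r] r by simp
  qed
  have "S j \<le> S k"
  proof (cases "j < k")
    case True
    then obtain r where r: "r \<in> {k..n + 1}" "S j < S r" using below[of j] j k1 by auto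
    then have "S r \<le> S k" using above[of r] by (cases "r = k") auto
    then show ?thesis using r by simp
  next
    case False
    then show ?thesis using above[of j] j by (cases "j = k") auto
  qed
  then show ?thesis by (simp add: S_def U)
qed

section \<open>The bounded isotonic fit\<close>

definition bounded_fit ::
    "nat \<Rightarrow> (nat \<Rightarrow> real) \<Rightarrow> (nat \<Rightarrow> real) \<Rightarrow> (nat \<Rightarrow> real) \<Rightarrow> nat \<Rightarrow> real" where
  "bounded_fit n y w b i = Max ((\<lambda>s. min (G n y w s i) (b s)) ` {1..i})"

lemma le_Av_iff:
  assumes "finite A" "A \<noteq> {}" "\<And>i. i \<in> A \<Longrightarrow> 0 < w i"
  shows "t \<le> Av y w A \<longleftrightarrow> 0 \<le> (\<Sum>i\<in>A. w i * (y i - t))"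
proof -
  have "0 < sum w A" using assms by (intro sum_pos) auto
  then show ?thesis
    by (simp add: Av_def pos_le_divide_eq sum_distrib_left algebra_simps sum_subtractf)
qed

text \<open>Unfolding max, min and averages at a threshold gives exactly the membership condition of
  \<open>U\<close> in \<open>sum_tail_le_sum_max_upper_set\<close>, for the summands
  \<open>w l * (y l - t)\<close> and starts with \<open>t \<le> b s\<close>.\<close>

lemma le_bounded_fit_iff:
  assumes "\<forall>i\<in>{1..n}. 0 < w i" "i \<in> {1..n}"
  shows "t \<le> bounded_fit n y w b i \<longleftrightarrow>
    (\<exists>s\<in>{1..i}. t \<le> b s \<and> (\<forall>r\<in>{i..n}. 0 \<le> (\<Sum>l\<in>{s..r}. w l * (y l - t))))"
proof -
  have "t \<le> Av y w {s..r} \<longleftrightarrow> 0 \<le> (\<Sum>l\<in>{s..r}. w l * (y l - t))"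
    if "s \<in> {1..i}" "r \<in> {i..n}" for s r
    using that assms by (intro le_Av_iff) auto
  then show ?thesis
    using assms(2) by (auto simp: bounded_fit_def G_def Max_ge_iff Min_ge_iff)
qed

lemma bounded_fit_le:
  assumes "mono_on {1..n} b" "i \<in> {1..n}"
  shows "bounded_fit n y w b i \<le> b i"
proof -
  have "b s \<le> b i" if "s \<in> {1..i}" for s
    using assms that by (auto intro: mono_onD)
  then show ?thesis
    using assms(2) by (auto simp: bounded_fit_def min_le_iff_disj)
qed

text \<open>A witness \<open>s\<close> for a threshold at \<open>i\<close> remains one at
  \<open>j \<ge> i\<close>: the range of \<open>s\<close> grows and that of \<open>r\<close>
  shrinks.\<close>

lemma mono_on_bounded_fit:
  assumes "\<forall>i\<in>{1..n}. 0 < w i"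
  shows "mono_on {1..n} (bounded_fit n y w b)"
proof (rule mono_onI)
  fix i j assume ij: "i \<in> {1..n}" "j \<in> {1..n}" "i \<le> j"
  obtain s where "s \<in> {1..i}" "bounded_fit n y w b i \<le> b s"
    "\<forall>r\<in>{i..n}. 0 \<le> (\<Sum>l\<in>{s..r}. w l * (y l - bounded_fit n y w b i))"
    using le_bounded_fit_iff[OF assms ij(1)] by blast
  with ij show "bounded_fit n y w b i \<le> bounded_fit n y w b j"
    by (subst le_bounded_fit_iff[OF assms ij(2)]) (intro bexI[of _ s], auto)
qed

text \<open>The derivative of \<open>(y - t)^2\<close> in \<open>t\<close> is
  \<open>2 * (t - y)\<close>. Only the upper endpoint of integration depends on \<open>c\<close>, so
  two fits can be compared at each \<open>t\<close> separately.\<close>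

lemma has_integral_threshold_square:
  fixes c y m M :: real
  assumes "m \<le> c" "c \<le> M"
  shows "((\<lambda>t. if t \<le> c then 2 * (t - y) else 0) has_integral ((y - c)\<^sup>2 - (y - m)\<^sup>2)) {m..M}"
proof -
  have "((\<lambda>t. 2 * (t - y)) has_integral ((y - c)\<^sup>2 - (y - m)\<^sup>2)) {m..c}"
    using assms(1)
    by (intro fundamental_theorem_of_calculus)
      (auto intro!: derivative_eq_intros simp flip: has_real_derivative_iff_has_vector_derivative)
  then have "((\<lambda>t. if t \<in> {m..c} then 2 * (t - y) else 0)
      has_integral ((y - c)\<^sup>2 - (y - m)\<^sup>2)) {m..M}"
    using assms by (subst has_integral_restrict) auto
  then show ?thesis
    by (rule has_integral_eq[rotated]) auto
qed

text \<open>Each side is \<open>-2\<close> times the sum of \<open>x\<close> over a superlevel set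
  at \<open>t\<close>, so the claim is that the superlevel set of the fit has the larger
  sum.\<close>

lemma bounded_fit_threshold_le:
  assumes w: "\<forall>i\<in>{1..n}. 0 < w i"
    and c: "mono_on {1..n} c" "\<forall>i\<in>{1..n}. c i \<le> b i"
  shows "(\<Sum>i=1..n. w i * (if t \<le> bounded_fit n y w b i then 2 * (t - y i) else 0))
    \<le> (\<Sum>i=1..n. w i * (if t \<le> c i then 2 * (t - y i) else 0))"
proof -
  define x where "x = (\<lambda>i. w i * (y i - t))"
  have eq: "(\<Sum>i=1..n. w i * (if t \<le> f i then 2 * (t - y i) else 0))
    = - 2 * sum x {i \<in> {1..n}. t \<le> f i}" for f
    unfolding sum.inter_filter[OF finite_atLeastAtMost] sum_distrib_left x_def
    by (intro sum.cong) (auto simp: algebra_simps)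
  \<comment> \<open>The superlevel set of the monotone \<open>c\<close> is the tail from
    \<open>j\<close>, empty for \<open>j = n + 1\<close>. Otherwise
    \<open>t \<le> c j \<le> b j\<close> makes \<open>j\<close> an admissible start.\<close>
  define j where "j = Min (insert (n + 1) {i \<in> {1..n}. t \<le> c i})"
  have j_cases: "j = n + 1 \<or> j \<in> {1..n} \<and> t \<le> c j"
    using Min_in[of "insert (n + 1) {i \<in> {1..n}. t \<le> c i}"] by (auto simp: j_def)
  have j_le: "j \<le> i" if "i \<in> {1..n}" "t \<le> c i" for i
    using that by (simp add: j_def)
  have "t \<le> c i" if "i \<in> {j..n}" for i
  proof -
    have j: "j \<in> {1..n}" "t \<le> c j" using j_cases that by auto
    have "c j \<le> c i" using that j by (intro mono_onD[OF c(1)]) auto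
    then show ?thesis using j by simp
  qed
  moreover have "1 \<le> j" using j_cases by auto
  ultimately have upper: "{i \<in> {1..n}. t \<le> c i} = {j..n}"
    by (intro equalityI subsetI) (use j_le in auto)
  have "sum x {j..n} \<le> sum x {i \<in> {1..n}. \<exists>s\<in>{1..i}. t \<le> b s \<and> (\<forall>r\<in>{i..n}. 0 \<le> sum x {s..r})}"
    using j_cases c(2) by (intro sum_tail_le_sum_max_upper_set) force+
  also have "{i \<in> {1..n}. \<exists>s\<in>{1..i}. t \<le> b s \<and> (\<forall>r\<in>{i..n}. 0 \<le> sum x {s..r})}
    = {i \<in> {1..n}. t \<le> bounded_fit n y w b i}"
    using le_bounded_fit_iff[OF w, of _ t y b] by (auto simp: x_def)
  finally show ?thesis unfolding eq upper by simp
qed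

lemma bounded_fit_least_squares:
  assumes w: "\<forall>i\<in>{1..n}. 0 < w i"
    and c: "mono_on {1..n} c" "\<forall>i\<in>{1..n}. c i \<le> b i"
  shows "(\<Sum>i=1..n. w i * (y i - bounded_fit n y w b i)\<^sup>2) \<le> (\<Sum>i=1..n. w i * (y i - c i)\<^sup>2)"
proof -
  let ?a = "bounded_fit n y w b"
  \<comment> \<open>A common interval \<open>{m..M}\<close> contains all values of both fits, so the
    same terms \<open>(y i - m)^2\<close> appear on both sides and cancel.\<close>
  define V where "V = insert 0 (?a ` {1..n} \<union> c ` {1..n})"
  define m M where "m = Min V" and "M = Max V"
  have V: "finite V" by (simp add: V_def)
  have integral: "((\<lambda>t. \<Sum>i=1..n. w i * (if t \<le> f i then 2 * (t - y i) else 0))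
      has_integral (\<Sum>i=1..n. w i * ((y i - f i)\<^sup>2 - (y i - m)\<^sup>2))) {m..M}"
    if "f ` {1..n} \<subseteq> V" for f
  proof (intro has_integral_sum has_integral_mult_right has_integral_threshold_square)
    show "m \<le> f i" "f i \<le> M" if "i \<in> {1..n}" for i
      using that V \<open>f ` {1..n} \<subseteq> V\<close> by (auto simp: m_def M_def intro!: Min_le Max_ge)
  qed simp
  have "(\<Sum>i=1..n. w i * ((y i - ?a i)\<^sup>2 - (y i - m)\<^sup>2))
      \<le> (\<Sum>i=1..n. w i * ((y i - c i)\<^sup>2 - (y i - m)\<^sup>2))"
    by (rule has_integral_le[OF integral integral])
      (use bounded_fit_threshold_le[OF w c] in \<open>auto simp: V_def\<close>)
  then show ?thesis by (simp add: right_diff_distrib sum_subtractf)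
qed

section \<open>Partial minimization\<close>

text \<open>Each summand is a weighted square, whose convexity defect is
  \<open>w * u * v * (a - b)^2\<close>.\<close>

lemma convex_on_L2:
  assumes "\<forall>i\<in>{1..n}. 0 < w1 i" "\<forall>i\<in>{1..n}. 0 < w2 i"
  shows "convex_on UNIV (L2 n y z w1 w2)"
proof -
  have sq: "w * (p - (u * a + v * b))\<^sup>2 \<le> u * (w * (p - a)\<^sup>2) + v * (w * (p - b)\<^sup>2)"
    if "0 < w" "0 \<le> u" "0 \<le> v" "u + v = 1" for w p u v a b :: real
  proof -
    have v: "v = 1 - u" using that by simp
    have "u * (w * (p - a)\<^sup>2) + v * (w * (p - b)\<^sup>2) - w * (p - (u * a + v * b))\<^sup>2
        = w * u * v * (a - b)\<^sup>2"
      by (simp add: v power2_eq_square algebra_simps)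
    moreover have "0 \<le> w * u * v * (a - b)\<^sup>2" using that by simp
    ultimately show ?thesis by linarith
  qed
  show ?thesis
    unfolding convex_on_def
  proof (safe intro!: convex_UNIV)
    fix a b a' b' :: "nat \<Rightarrow> real" and u v :: real
    assume uv: "0 \<le> u" "0 \<le> v" "u + v = 1"
    have "(\<Sum>i=1..n. w1 i * (y i - (u * a i + v * a' i))\<^sup>2)
        \<le> (\<Sum>i=1..n. u * (w1 i * (y i - a i)\<^sup>2) + v * (w1 i * (y i - a' i)\<^sup>2))"
      using assms uv by (intro sum_mono sq) auto
    moreover have "(\<Sum>i=1..n. w2 i * (z i - (u * b i + v * b' i))\<^sup>2)
        \<le> (\<Sum>i=1..n. u * (w2 i * (z i - b i)\<^sup>2) + v * (w2 i * (z i - b' i)\<^sup>2))"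
      using assms uv by (intro sum_mono sq) auto
    ultimately show "L2 n y z w1 w2 (u *\<^sub>R (a, b) + v *\<^sub>R (a', b'))
        \<le> u * L2 n y z w1 w2 (a, b) + v * L2 n y z w1 w2 (a', b')"
      by (simp add: L2_def scaleR_fun_def sum.distrib sum_distrib_left distrib_left)
  qed
qed

lemma mono_on_convex_combination:
  fixes f g :: "nat \<Rightarrow> real"
  assumes "mono_on A f" "mono_on A g" "0 \<le> u" "0 \<le> v"
  shows "mono_on A (u *\<^sub>R f + v *\<^sub>R g)"
  using assms by (auto simp: mono_on_def scaleR_fun_def intro!: add_mono mult_left_mono)

lemma convex_ordered_pairs: "convex (ordered_pairs n)"
  by (auto simp: convex_def ordered_pairs_def Rvec_def scaleR_fun_def
      intro!: mono_on_convex_combination[unfolded scaleR_fun_def real_scaleR_def] add_mono mult_left_mono)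

lemma convex_bounded_mono: "convex (bounded_mono m \<beta>)"
  by (auto simp: convex_def bounded_mono_def Rvec_def scaleR_fun_def
      intro!: mono_on_convex_combination[unfolded scaleR_fun_def real_scaleR_def] convex_bound_le)

context
  fixes n :: nat and y z w1 w2 :: "nat \<Rightarrow> real" and \<beta> :: real
  assumes n: "2 \<le> n" and w1: "\<forall>i\<in>{1..n}. 0 < w1 i" and w2: "\<forall>i\<in>{1..n}. 0 < w2 i"
begin

definition fit_pair :: "(nat \<Rightarrow> real) \<Rightarrow> (nat \<Rightarrow> real) \<times> (nat \<Rightarrow> real)" where
  "fit_pair b = (\<lambda>i. if i \<in> {1..n} then bounded_fit n y w1 (b(n := \<beta>)) i else 0, b(n := \<beta>))"

lemma mono_on_extend:
  assumes "b \<in> bounded_mono (n - 1) \<beta>"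
  shows "mono_on {1..n} (b(n := \<beta>))"
proof (rule mono_onI)
  fix i j assume ij: "i \<in> {1..n}" "j \<in> {1..n}" "i \<le> j"
  have mono: "mono_on {1..n - 1} b" and le: "b (n - 1) \<le> \<beta>"
    using assms by (auto simp: bounded_mono_def)
  have "b i \<le> \<beta>" if "i < n"
  proof -
    have "b i \<le> b (n - 1)" using ij that by (intro mono_onD[OF mono]) auto
    then show ?thesis using le by simp
  qed
  then show "(b(n := \<beta>)) i \<le> (b(n := \<beta>)) j"
    using mono_onD[OF mono, of i j] ij by auto
qed

lemma fit_pair_in_ordered_pairs:
  assumes "b \<in> bounded_mono (n - 1) \<beta>"
  shows "fit_pair b \<in> ordered_pairs n"
proof -
  have "b(n := \<beta>) \<in> Rvec n"
    using assms n by (auto simp: bounded_mono_def Rvec_def)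
  moreover have "mono_on {1..n} (fst (fit_pair b))"
    using mono_on_bounded_fit[OF w1, of y "b(n := \<beta>)"] by (auto simp: mono_on_def fit_pair_def)
  ultimately show ?thesis
    using mono_on_extend[OF assms] bounded_fit_le[OF mono_on_extend[OF assms]]
    by (auto simp: ordered_pairs_def fit_pair_def Rvec_def)
qed

lemma L2_extend:
  "L2 n y z w1 w2 (a, b(n := \<beta>)) = (\<Sum>i=1..n. w1 i * (y i - a i)\<^sup>2)
    + (\<Sum>i=1..n - 1. (b i - z i)\<^sup>2 * w2 i) + w2 n * (z n - \<beta>)\<^sup>2"
proof -
  obtain m where m: "n = Suc m" using n by (cases n) auto
  have "(\<Sum>i=1..m. w2 i * (z i - (b(n := \<beta>)) i)\<^sup>2) = (\<Sum>i=1..m. (b i - z i)\<^sup>2 * w2 i)"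
    using m by (intro sum.cong) (auto simp: power2_commute mult.commute)
  then show ?thesis by (simp add: L2_def m)
qed

lemma L2_fit_pair: "L2 n y z w1 w2 (fit_pair b) = Psi n y z w1 w2 \<beta> b + w2 n * (z n - \<beta>)\<^sup>2"
proof -
  have "(\<Sum>i=1..n. w1 i * (y i - (if i \<in> {1..n} then bounded_fit n y w1 (b(n := \<beta>)) i else 0))\<^sup>2)
    = (\<Sum>i=1..n. (bounded_fit n y w1 (b(n := \<beta>)) i - y i)\<^sup>2 * w1 i)"
    by (intro sum.cong) (auto simp: power2_commute mult.commute)
  then show ?thesis
    unfolding fit_pair_def L2_extend Psi_def bounded_fit_def by simp
qed

text \<open>The fit is the best first component for a fixed second one. With
  \<open>L2_fit_pair\<close> this exhibits \<open>Psi\<close>, up to the constant contributed by the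
  entry \<open>\<beta>\<close>, as a partial minimum of \<open>L2\<close>.\<close>

lemma Psi_le_L2:
  assumes "(a, b(n := \<beta>)) \<in> ordered_pairs n"
  shows "Psi n y z w1 w2 \<beta> b + w2 n * (z n - \<beta>)\<^sup>2 \<le> L2 n y z w1 w2 (a, b(n := \<beta>))"
proof -
  have "(\<Sum>i=1..n. w1 i * (y i - bounded_fit n y w1 (b(n := \<beta>)) i)\<^sup>2)
      \<le> (\<Sum>i=1..n. w1 i * (y i - a i)\<^sup>2)"
    using assms by (intro bounded_fit_least_squares w1) (auto simp: ordered_pairs_def)
  then have "L2 n y z w1 w2 (fit_pair b) \<le> L2 n y z w1 w2 (a, b(n := \<beta>))"
    unfolding fit_pair_def L2_extend by simp
  then show ?thesis by (simp add: L2_fit_pair)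
qed

lemma convex_on_Psi: "convex_on (bounded_mono (n - 1) \<beta>) (Psi n y z w1 w2 \<beta>)"
  unfolding convex_on_def
proof (intro conjI convex_bounded_mono ballI allI impI)
  fix b b' and u v :: real
  assume b: "b \<in> bounded_mono (n - 1) \<beta>" and b': "b' \<in> bounded_mono (n - 1) \<beta>"
    and uv: "0 \<le> u" "0 \<le> v" "u + v = 1"
  define C where "C = w2 n * (z n - \<beta>)\<^sup>2"
  \<comment> \<open>As the weights sum to 1, the last entry stays \<open>\<beta>\<close>, and
    extending by \<open>\<beta>\<close> commutes with the convex combination.\<close>
  have "u * \<beta> + v * \<beta> = \<beta>" using uv by (simp flip: distrib_right)
  then have "(u *\<^sub>R b + v *\<^sub>R b')(n := \<beta>) = u *\<^sub>R (b(n := \<beta>)) + v *\<^sub>R (b'(n := \<beta>))"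
    by (auto simp: fun_eq_iff scaleR_fun_def)
  then have pair: "u *\<^sub>R fit_pair b + v *\<^sub>R fit_pair b'
      = (u *\<^sub>R fst (fit_pair b) + v *\<^sub>R fst (fit_pair b'), (u *\<^sub>R b + v *\<^sub>R b')(n := \<beta>))"
    by (simp add: fit_pair_def)
  \<comment> \<open>The combination need not be a fit itself; being feasible is enough to bound
    \<open>Psi\<close> from above.\<close>
  have "u *\<^sub>R fit_pair b + v *\<^sub>R fit_pair b' \<in> ordered_pairs n"
    using convexD[OF convex_ordered_pairs] fit_pair_in_ordered_pairs b b' uv by blast
  then have "Psi n y z w1 w2 \<beta> (u *\<^sub>R b + v *\<^sub>R b') + C
      \<le> L2 n y z w1 w2 (u *\<^sub>R fit_pair b + v *\<^sub>R fit_pair b')"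
    unfolding pair C_def by (rule Psi_le_L2)
  also have "\<dots> \<le> u * L2 n y z w1 w2 (fit_pair b) + v * L2 n y z w1 w2 (fit_pair b')"
    using convex_on_L2[OF w1 w2, of y z] uv unfolding convex_on_def by blast
  also have "\<dots> = u * Psi n y z w1 w2 \<beta> b + v * Psi n y z w1 w2 \<beta> b' + (u + v) * C"
    by (simp add: L2_fit_pair C_def algebra_simps)
  finally show "Psi n y z w1 w2 \<beta> (u *\<^sub>R b + v *\<^sub>R b')
      \<le> u * Psi n y z w1 w2 \<beta> b + v * Psi n y z w1 w2 \<beta> b'"
    using uv by simp
qed

end

theorem proposition3p4:
  fixes n :: nat and y z w1 w2 as bs :: "nat \<Rightarrow> real"
  assumes "n \<ge> 2"
    and "y \<in> Rvec n" "z \<in> Rvec n" "w1 \<in> Rvec n" "w2 \<in> Rvec n"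
    and "\<forall>i\<in>{1..n}. w1 i > 0" "\<forall>i\<in>{1..n}. w2 i > 0"
    and "is_unique_minimizer (L2 n y z w1 w2) (ordered_pairs n) (as, bs)"
  shows "convex_on (bounded_mono (n - 1) (bs n)) (Psi n y z w1 w2 (bs n)) \<and>
    is_unique_minimizer (Psi n y z w1 w2 (bs n)) (bounded_mono (n - 1) (bs n))
      (\<lambda>i. if i \<in> {1..n - 1} then bs i else 0)"
proof
  note ctx = assms(1) assms(6) assms(7)
  let ?L = "L2 n y z w1 w2" and ?\<Psi> = "Psi n y z w1 w2 (bs n)"
  let ?S = "bounded_mono (n - 1) (bs n)" and ?fp = "fit_pair n y w1 (bs n)"
  let ?b = "\<lambda>i. if i \<in> {1..n - 1} then bs i else 0"
  define C where "C = w2 n * (z n - bs n)\<^sup>2"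
  show "convex_on ?S ?\<Psi>" by (rule convex_on_Psi[OF ctx])
  have mem: "(as, bs) \<in> ordered_pairs n"
    and min: "\<And>p. p \<in> ordered_pairs n \<Longrightarrow> ?L (as, bs) \<le> ?L p"
    and uniq: "\<And>p. is_arg_min ?L (\<lambda>v. v \<in> ordered_pairs n) p \<Longrightarrow> p = (as, bs)"
    using assms(8) by (auto simp: is_unique_minimizer_def is_arg_min_linorder)
  have "bs \<in> Rvec n" and mono: "mono_on {1..n} bs"
    using mem by (auto simp: ordered_pairs_def)
  then have ext: "?b(n := bs n) = bs"
    using assms(1) by (fastforce simp: fun_eq_iff Rvec_def)
  have b_mem: "?b \<in> ?S"
  proof -
    have "mono_on {1..n - 1} bs" using mono by (rule mono_on_subset) auto
    then have "mono_on {1..n - 1} ?b" by (simp add: mono_on_def)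
    moreover have "bs (n - 1) \<le> bs n" using assms(1) by (intro mono_onD[OF mono]) auto
    ultimately show ?thesis using assms(1) by (auto simp: bounded_mono_def Rvec_def)
  qed
  \<comment> \<open>Extending \<open>?b\<close> gives back \<open>bs\<close>, so \<open>as\<close>
    competes with the fit below \<open>bs\<close>. Hence \<open>?\<Psi> ?b + C\<close> is a lower
    bound for \<open>?L\<close> on all ordered pairs.\<close>
  have "?\<Psi> ?b + C \<le> ?L (as, bs)"
    using Psi_le_L2[OF ctx, of as ?b "bs n" y z] mem unfolding ext C_def by simp
  then have le: "?\<Psi> ?b + C \<le> ?L p" if "p \<in> ordered_pairs n" for p
    using min[OF that] by simp
  have fp: "?fp v \<in> ordered_pairs n" "?L (?fp v) = ?\<Psi> v + C" if "v \<in> ?S" for v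
    using fit_pair_in_ordered_pairs[OF ctx that] L2_fit_pair[OF ctx] by (auto simp: C_def)
  have le_Psi: "?\<Psi> ?b \<le> ?\<Psi> v" if "v \<in> ?S" for v
    using le[OF fp(1)[OF that]] fp(2)[OF that] by simp
  have "v = ?b" if v: "is_arg_min ?\<Psi> (\<lambda>v. v \<in> ?S) v" for v
  proof -
    have vS: "v \<in> ?S" and "?\<Psi> v \<le> ?\<Psi> ?b"
      using v b_mem by (auto simp: is_arg_min_linorder)
    \<comment> \<open>A minimizer of \<open>?\<Psi>\<close> attains this lower bound through its fit
      pair, so uniqueness for \<open>?L\<close> determines it.\<close>
    then have "is_arg_min ?L (\<lambda>p. p \<in> ordered_pairs n) (?fp v)"
      using fp[OF vS] le by (force simp: is_arg_min_linorder)
    then have "?fp v = (as, bs)" by (rule uniq)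
    then have "v(n := bs n) = bs" by (simp add: fit_pair_def[OF ctx])
    \<comment> \<open>At \<open>i = n\<close> the update hides \<open>v\<close>; there
      \<open>v\<close> and \<open>?b\<close> both vanish because they lie in
      \<open>Rvec (n - 1)\<close>.\<close>
    then have "v i = bs i" if "i \<noteq> n" for i
      using that by (metis fun_upd_other)
    then show "v = ?b"
      using vS assms(1) by (auto simp: fun_eq_iff bounded_mono_def Rvec_def)
  qed
  then show "is_unique_minimizer ?\<Psi> ?S ?b"
    using b_mem le_Psi by (auto simp: is_unique_minimizer_def is_arg_min_linorder)
qed

end
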